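(* Let $A$, $B$ be nonsingular primitive $N\times N$ matrices with nonnegative integer entries, with $N\ge 3$. Suppose that their Perron--Frobenius eigenvalues $\lambda_{(A)}$, $\lambda_{(B)}$ are integers, that $\lambda_{(A)}=|\det A|$ and $\lambda_{(B)}=|\det B|$, that $\lambda_{(A)}$ and $\lambda_{(B)}$ are divisible by the same primes, and that $\langle v(A)\mid w(A)\rangle=\langle v(B)\mid w(B)\rangle$, where $v(\cdot)$ and $w(\cdot)$ denote the left (row) and right (column) Perron--Frobenius eigenvectors normalized to have positive integer entries with greatest common divisor $1$. Then there exists an isomorphism between the ordered dimension groups $G(A)$ and $G(B)$.
   Context: A square nonnegative integer matrix is primitive if some power has only strictly positive entries; its Perron--Frobenius eigenvalue is the positive eigenvalue strictly dominating all others in absolute value. For a nonsingular primitive $N\times N$ matrix $A$, $G(A)=\bigcup_{n\ge 0}A^{-n}\mathbb{Z}^N\subset\mathbb{Q}^N$ (column vectors), ordered by the positive cone $\bigcup_{n\ge 0}A^{-n}(\mathbb{Z}_{\ge0}^N)$. An isomorphism of ordered groups is a group isomorphism carrying the positive cone onto the positive cone. $\langle v\mid w\rangle=\sum_i v_iw_i$. *)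

theory Defs
  imports "Jordan_Normal_Form.Char_Poly" "Jordan_Normal_Form.Gauss_Jordan_Elimination" Complex_Main
begin

definition nonneg_int_mat :: "int mat \<Rightarrow> bool" where
  "nonneg_int_mat A \<longleftrightarrow> (\<forall>i<dim_row A. \<forall>j<dim_col A. 0 \<le> A $$ (i,j))"

definition primitive_mat :: "int mat \<Rightarrow> bool" where
  "primitive_mat A \<longleftrightarrow> square_mat A \<and> nonneg_int_mat A \<and>
     (\<exists>k>0. \<forall>i<dim_row A. \<forall>j<dim_col A. 0 < (A ^\<^sub>m k) $$ (i,j))"

definition perron_eigenvalue :: "int mat \<Rightarrow> real \<Rightarrow> bool" where
  "perron_eigenvalue A l \<longleftrightarrow> 0 < l \<and> eigenvalue (map_mat complex_of_int A) (complex_of_real l) \<and>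
     (\<forall>z. eigenvalue (map_mat complex_of_int A) z \<and> z \<noteq> complex_of_real l \<longrightarrow> cmod z < l)"

lemma perron_eigenvalue_unique:
  assumes "perron_eigenvalue A l" "perron_eigenvalue A l'"
  shows "l = l'"
  using assms unfolding perron_eigenvalue_def
  by (metis norm_of_real abs_of_pos less_asym of_real_eq_iff)

definition right_perron_vector :: "int mat \<Rightarrow> int vec \<Rightarrow> bool" where
  "right_perron_vector A w \<longleftrightarrow>
     (\<exists>l. perron_eigenvalue A l \<and>
          eigenvector (map_mat real_of_int A) (map_vec real_of_int w) l) \<and>
     (\<forall>i<dim_vec w. 0 < w $ i) \<and> Gcd (set\<^sub>v w) = 1"

text \<open>Row vectors are represented by the same type as column vectors; the equation
  $v A = \lambda v$ becomes $A^T v = \lambda v$, where $\lambda$ is the Perron--Frobenius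
  eigenvalue of $A$ itself.\<close>

definition left_perron_vector :: "int mat \<Rightarrow> int vec \<Rightarrow> bool" where
  "left_perron_vector A v \<longleftrightarrow>
     (\<exists>l. perron_eigenvalue A l \<and>
          eigenvector (transpose_mat (map_mat real_of_int A)) (map_vec real_of_int v) l) \<and>
     (\<forall>i<dim_vec v. 0 < v $ i) \<and> Gcd (set\<^sub>v v) = 1"

text \<open>The matrix $A^{-1}$ over the rationals; only meaningful if $\det A \neq 0$, since
  \<^const>\<open>mat_inverse\<close> returns \<^const>\<open>None\<close> otherwise.\<close>

definition rat_inverse :: "int mat \<Rightarrow> rat mat" where
  "rat_inverse A = the (mat_inverse (map_mat rat_of_int A))"

definition dim_group_carrier :: "int mat \<Rightarrow> rat vec set" where
  "dim_group_carrier A =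
     (\<Union>n. {(rat_inverse A ^\<^sub>m n) *\<^sub>v map_vec rat_of_int z | z. z \<in> carrier_vec (dim_row A)})"

definition dim_group_cone :: "int mat \<Rightarrow> rat vec set" where
  "dim_group_cone A =
     (\<Union>n. {(rat_inverse A ^\<^sub>m n) *\<^sub>v map_vec rat_of_int z | z.
              z \<in> carrier_vec (dim_row A) \<and> (\<forall>i<dim_row A. 0 \<le> z $ i)})"

text \<open>The additive group $G(A)$ as a subgroup of $\mathbb{Q}^N$; the operation
  \<^const>\<open>mult\<close> of the record is vector addition.\<close>

definition dim_group :: "int mat \<Rightarrow> rat vec monoid" where
  "dim_group A = (monoid_vec TYPE(rat) (dim_row A)) \<lparr>carrier := dim_group_carrier A\<rparr>"

definition ordered_dim_group_iso :: "int mat \<Rightarrow> int mat \<Rightarrow> (rat vec \<Rightarrow> rat vec) \<Rightarrow> bool" where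
  "ordered_dim_group_iso A B f \<longleftrightarrow>
     f \<in> iso (dim_group A) (dim_group B) \<and> f ` dim_group_cone A = dim_group_cone B"

end

theory Submission
  imports Defs
begin

text \<open>Write \<open>\<lambda>\<close> for the Perron eigenvalue of \<open>A\<close>. Since \<open>\<lambda> = \<bar>det A\<bar>\<close>, the matrix \<open>A\<close> acts with
  determinant \<open>\<plusminus>1\<close> on the lattice orthogonal to \<open>v\<close>, and so \<open>A\<^sup>k \<int>\<^sup>N\<close> consists of the integral \<open>y\<close> with
  \<open>\<lambda>\<^sup>k\<close> dividing \<open>\<langle>v, y\<rangle>\<close>. This makes \<open>\<langle>v, w\<rangle>\<close> coprime to \<open>\<lambda>\<close> and gives
  \<open>G(A) = \<int>\<^sup>N + \<int>[1/\<lambda>] w\<close>, with cone \<open>{0} \<union> {x. \<langle>v, x\<rangle> > 0}\<close>. Thus \<open>G(A)\<close> depends only on the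
  pair \<open>(v, w)\<close> and the primes dividing \<open>\<lambda>\<close>. For \<open>N \<ge> 3\<close> the group \<open>GL\<^sub>N(\<int>)\<close> acts transitively on the
  pairs of primitive vectors with given \<open>\<langle>v, w\<rangle>\<close>, and a matrix that carries the pair of \<open>A\<close> to
  the pair of \<open>B\<close> is the isomorphism.\<close>

section \<open>Unimodular integer matrices and row reduction of integer vectors\<close>

definition unimodular :: "nat \<Rightarrow> int mat \<Rightarrow> bool" where
  "unimodular n U \<longleftrightarrow> U \<in> carrier_mat n n \<and>
     (\<exists>V\<in>carrier_mat n n. U * V = 1\<^sub>m n \<and> V * U = 1\<^sub>m n)"

text \<open>Multiplying from the left by such a matrix keeps the first \<open>k\<close> rows of the
  other factor. This allows a row \<open>v\<close> that is already in place to survive later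
  reductions.\<close>

definition fixes_coords :: "nat \<Rightarrow> nat \<Rightarrow> int mat \<Rightarrow> bool" where
  "fixes_coords n k U \<longleftrightarrow> (\<forall>i<k. row U i = unit_vec n i)"

text \<open>Coprimality of the entries, stated through common divisors so that no gcd has to be
  computed. For \<open>n = 0\<close> the premise is vacuous and no vector qualifies, which yields
  \<open>n_pos\<close> below.\<close>

definition primitive_vec :: "nat \<Rightarrow> int vec \<Rightarrow> bool" where
  "primitive_vec n x \<longleftrightarrow> x \<in> carrier_vec n \<and> (\<forall>c. (\<forall>i<n. c dvd x $ i) \<longrightarrow> c dvd 1)"

lemma unimodularI:
  assumes "U \<in> carrier_mat n n" "V \<in> carrier_mat n n" "U * V = 1\<^sub>m n" "V * U = 1\<^sub>m n"
  shows "unimodular n U"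
  using assms unfolding unimodular_def by blast

lemma unimodular_carrier: "unimodular n U \<Longrightarrow> U \<in> carrier_mat n n"
  by (simp add: unimodular_def)

lemma unimodular_mult:
  assumes "unimodular n U" "unimodular n V"
  shows "unimodular n (U * V)"
proof -
  obtain U' V' where U': "U' \<in> carrier_mat n n" "U * U' = 1\<^sub>m n" "U' * U = 1\<^sub>m n"
    and V': "V' \<in> carrier_mat n n" "V * V' = 1\<^sub>m n" "V' * V = 1\<^sub>m n"
    using assms unfolding unimodular_def by blast
  have c: "U \<in> carrier_mat n n" "V \<in> carrier_mat n n" using assms by (auto simp: unimodular_def)
  have "V * (V' * U') = U'" "U' * (U * V) = V"
    using c U' V' by (simp_all add: assoc_mult_mat[of _ n n _ n _ n, symmetric])
  then have "(U * V) * (V' * U') = 1\<^sub>m n" "(V' * U') * (U * V) = 1\<^sub>m n"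
    using c U' V' by (simp_all add: assoc_mult_mat[of _ n n _ n _ n])
  then show ?thesis using c U' V' by (intro unimodularI[of _ _ "V' * U'"]) auto
qed

lemma unimodular_transpose:
  assumes "unimodular n U"
  shows "unimodular n (transpose_mat U)"
proof -
  obtain V where V: "U \<in> carrier_mat n n" "V \<in> carrier_mat n n" "U * V = 1\<^sub>m n" "V * U = 1\<^sub>m n"
    using assms unfolding unimodular_def by blast
  then show ?thesis
    by (intro unimodularI[of _ _ "transpose_mat V"])
      (auto simp: transpose_mult[symmetric, of _ n n _ n])
qed

lemma unimodular_one: "unimodular n (1\<^sub>m n)"
  by (intro unimodularI[of _ _ "1\<^sub>m n"]) auto

lemma unimodular_addrow_mat:
  assumes "k < n" "l < n" "k \<noteq> l"
  shows "unimodular n (addrow_mat n a k l)"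
  using addrow_mat_inv[OF assms, of a] addrow_mat_inv[OF assms, of "- a"]
  by (intro unimodularI[of _ _ "addrow_mat n (- a) k l"]) auto

lemma unimodular_multrow_mat_uminus:
  assumes "k < n"
  shows "unimodular n (multrow_mat n k (- 1))"
proof -
  have "multrow_mat n k (- 1) * multrow_mat n k (- 1 :: int) = multrow k (- 1) (multrow_mat n k (- 1))"
    by (rule multrow_mat[symmetric]) auto
  also have "\<dots> = 1\<^sub>m n" by (rule eq_matI) auto
  finally show ?thesis by (intro unimodularI[of _ _ "multrow_mat n k (- 1)"]) auto
qed

lemma row_addrow_mat:
  assumes "i < n" "k < n" "l < n" "k \<noteq> l"
  shows "row (addrow_mat n (a::int) k l) i = (if i = k then a \<cdot>\<^sub>v unit_vec n l + unit_vec n k else unit_vec n i)"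
  using assms by (intro eq_vecI) auto

lemma addrow_mat_mult_vec:
  assumes "w \<in> carrier_vec n" "i < n" "k < n" "l < n" "k \<noteq> l"
  shows "(addrow_mat n (a::int) k l *\<^sub>v w) $ i = (if i = k then a * w $ l + w $ k else w $ i)"
  using assms by (simp add: row_addrow_mat add_scalar_prod_distrib[of _ n])

lemma row_multrow_mat:
  assumes "i < n" 
  shows "row (multrow_mat n k (a::int)) i = (if i = k then a \<cdot>\<^sub>v unit_vec n k else unit_vec n i)"
  using assms by (intro eq_vecI) auto

lemma multrow_mat_mult_vec:
  assumes "w \<in> carrier_vec n" "i < n"
  shows "(multrow_mat n k (a::int) *\<^sub>v w) $ i = (if i = k then a * w $ i else w $ i)"
  using assms by (simp add: row_multrow_mat)

lemma fixes_coords_one: "k \<le> n \<Longrightarrow> fixes_coords n k (1\<^sub>m n)"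
  by (auto simp: fixes_coords_def)

lemma fixes_coords_mult:
  assumes "U \<in> carrier_mat n n" "V \<in> carrier_mat n n" "fixes_coords n k U" "fixes_coords n k V" "k \<le> n"
  shows "fixes_coords n k (U * V)"
  unfolding fixes_coords_def
proof (intro allI impI)
  fix i assume i: "i < k"
  show "row (U * V) i = unit_vec n i"
  proof (rule eq_vecI)
    fix j assume j: "j < dim_vec (unit_vec n i :: int vec)"
    have "row (U * V) i $ j = row U i \<bullet> col V j" using assms i j by simp
    also have "\<dots> = unit_vec n i \<bullet> col V j" using assms i by (simp add: fixes_coords_def)
    also have "\<dots> = row V i $ j" using assms i j by simp
    also have "\<dots> = unit_vec n i $ j" using assms i by (simp add: fixes_coords_def)
    finally show "row (U * V) i $ j = unit_vec n i $ j" .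
  qed (use assms in simp)
qed

lemma fixes_coords_addrow_mat:
  assumes "k \<le> i" "i < n" "j < n" "i \<noteq> j"
  shows "fixes_coords n k (addrow_mat n a i j)"
  using assms by (auto simp: fixes_coords_def row_addrow_mat)

lemma fixes_coords_multrow_mat:
  assumes "k \<le> i" "i < n"
  shows "fixes_coords n k (multrow_mat n i a)"
  using assms by (auto simp: fixes_coords_def row_multrow_mat)

lemma fixes_coords_mult_vec:
  assumes "fixes_coords n k U" "U \<in> carrier_mat n n" "w \<in> carrier_vec n" "i < k" "k \<le> n"
  shows "(U *\<^sub>v w) $ i = w $ i"
  using assms by (simp add: fixes_coords_def)

text \<open>The divisor clause does not follow from the matrix clause: for \<open>k > 0\<close> a
  unimodular matrix fixing the first \<open>k\<close> coordinates may add multiples of them to the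
  later ones and so change the gcd of the tail. The clause pulls divisors of the reduced tail back
  to the original one.\<close>

definition row_equiv :: "nat \<Rightarrow> nat \<Rightarrow> int vec \<Rightarrow> int vec \<Rightarrow> bool" where
  "row_equiv n k w w' \<longleftrightarrow> w \<in> carrier_vec n \<and>
     (\<exists>U. unimodular n U \<and> fixes_coords n k U \<and> w' = U *\<^sub>v w) \<and>
     (\<forall>c. (\<forall>i\<in>{k..<n}. c dvd w' $ i) \<longrightarrow> (\<forall>i\<in>{k..<n}. c dvd w $ i))"

lemma row_equiv_refl:
  assumes "w \<in> carrier_vec n" "k \<le> n"
  shows "row_equiv n k w w"
  using assms unimodular_one fixes_coords_one
  unfolding row_equiv_def by (metis one_mult_mat_vec)

lemma row_equiv_trans:
  assumes "row_equiv n k x y" "row_equiv n k y z" "k \<le> n"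
  shows "row_equiv n k x z"
proof -
  from assms obtain U V where U: "unimodular n U" "fixes_coords n k U" "y = U *\<^sub>v x"
    and V: "unimodular n V" "fixes_coords n k V" "z = V *\<^sub>v y" and x: "x \<in> carrier_vec n"
    unfolding row_equiv_def by blast
  have "z = (V * U) *\<^sub>v x"
    using U V x by (simp add: assoc_mult_mat_vec[of _ n n _ n] unimodular_def)
  moreover have "unimodular n (V * U)" using U V by (simp add: unimodular_mult)
  moreover have "fixes_coords n k (V * U)"
    using U V assms(3) by (intro fixes_coords_mult) (auto simp: unimodular_def)
  ultimately show ?thesis using assms x unfolding row_equiv_def by blast
qed

lemma row_equiv_carrier:
  assumes "row_equiv n k w w'"
  shows "w \<in> carrier_vec n" "w' \<in> carrier_vec n"
  using assms unfolding row_equiv_def unimodular_def by (auto intro!: mult_mat_vec_carrier)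

text \<open>The source row \<open>j\<close> also lies in the tail, so a common divisor of the new
  tail divides \<open>w $ j\<close>, hence \<open>a * w $ j\<close>, hence
  \<open>w $ i\<close>.\<close>

lemma row_equiv_addrow:
  assumes "w \<in> carrier_vec n" "k \<le> i" "i < n" "k \<le> j" "j < n" "i \<noteq> j"
  shows "row_equiv n k w (addrow_mat n a i j *\<^sub>v w)"
  unfolding row_equiv_def
proof (intro conjI exI allI impI ballI)
  fix c l assume *: "\<forall>m\<in>{k..<n}. c dvd (addrow_mat n a i j *\<^sub>v w) $ m" and l: "l \<in> {k..<n}"
  have **: "c dvd (if m = i then a * w $ j + w $ i else w $ m)" if "m \<in> {k..<n}" for m
    using *[rule_format, OF that] addrow_mat_mult_vec[OF assms(1) _ assms(3,5,6), of m a] that by auto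
  have j: "c dvd w $ j" using **[of j] assms by simp
  show "c dvd w $ l"
  proof (cases "l = i")
    case True
    then show ?thesis using **[of i] l j by (simp add: dvd_add_right_iff)
  qed (use **[of l] l in simp)
qed (use assms unimodular_addrow_mat fixes_coords_addrow_mat in auto)

lemma row_equiv_uminus:
  assumes "w \<in> carrier_vec n" "k \<le> i" "i < n"
  shows "row_equiv n k w (multrow_mat n i (- 1) *\<^sub>v w)"
  unfolding row_equiv_def
proof (intro conjI exI allI impI ballI)
  fix c l assume *: "\<forall>m\<in>{k..<n}. c dvd (multrow_mat n i (- 1) *\<^sub>v w) $ m" and l: "l \<in> {k..<n}"
  show "c dvd w $ l"
    using *[rule_format, OF l] multrow_mat_mult_vec[OF assms(1), of l i "-1"] l by (auto split: if_splits)
qed (use assms unimodular_multrow_mat_uminus fixes_coords_multrow_mat in auto)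

text \<open>Euclid's algorithm on the coordinates from \<open>k\<close> on, by induction on the sum
  of their absolute values.\<close>

lemma row_equiv_reduce:
  assumes "w \<in> carrier_vec n" "k < n"
  shows "\<exists>w'. row_equiv n k w w' \<and> 0 \<le> w' $ k \<and> (\<forall>i. k < i \<longrightarrow> i < n \<longrightarrow> w' $ i = 0)"
  using assms(1)
proof (induction "\<Sum>i\<in>{k..<n}. nat \<bar>w $ i\<bar>" arbitrary: w rule: less_induct)
  case less
  show ?case
  proof (cases "\<exists>i j. k \<le> i \<and> i < n \<and> k \<le> j \<and> j < n \<and> i \<noteq> j \<and> w $ i \<noteq> 0 \<and> \<bar>w $ i\<bar> \<le> \<bar>w $ j\<bar>")
    case True
    then obtain i j where ij: "k \<le> i" "i < n" "k \<le> j" "j < n" "i \<noteq> j" "w $ i \<noteq> 0"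
      "\<bar>w $ i\<bar> \<le> \<bar>w $ j\<bar>" by blast
    \<comment> \<open>With this sign the new entry has absolute value
      \<open>\<bar>w $ j\<bar> - \<bar>w $ i\<bar>\<close>, so the measure drops because
      \<open>w $ i\<close> is nonzero.\<close>
    define a where "a = - sgn (w $ i) * sgn (w $ j)"
    define y where "y = addrow_mat n a j i *\<^sub>v w"
    have y: "y $ l = (if l = j then a * w $ i + w $ j else w $ l)" if "l < n" for l
      using less.prems that ij unfolding y_def by (intro addrow_mat_mult_vec) auto
    have eq: "row_equiv n k w y" unfolding y_def using less.prems ij by (intro row_equiv_addrow) auto
    have small: "\<bar>a * w $ i + w $ j\<bar> < \<bar>w $ j\<bar>"
      unfolding a_def using ij by (cases "w $ i" "0::int" rule: linorder_cases; cases "w $ j" "0::int" rule: linorder_cases) auto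
    have "(\<Sum>i\<in>{k..<n}. nat \<bar>y $ i\<bar>) < (\<Sum>i\<in>{k..<n}. nat \<bar>w $ i\<bar>)"
    proof (rule sum_strict_mono_ex1)
      show "\<forall>x\<in>{k..<n}. nat \<bar>y $ x\<bar> \<le> nat \<bar>w $ x\<bar>" using small y by auto
      show "\<exists>a\<in>{k..<n}. nat \<bar>y $ a\<bar> < nat \<bar>w $ a\<bar>"
        using small y ij by (intro bexI[of _ j]) auto
    qed simp
    from less.hyps[OF this row_equiv_carrier(2)[OF eq]] show ?thesis
      using row_equiv_trans[OF eq] assms(2) by (meson less_imp_le)
  next
    case False
    \<comment> \<open>Of two nonzero tail entries one would be at most the other in absolute value,
      so at most one is nonzero here. It remains to move it to position \<open>k\<close> and to
      correct its sign.\<close>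
    have *: "\<exists>y. row_equiv n k w y \<and> (\<forall>i. k < i \<longrightarrow> i < n \<longrightarrow> y $ i = 0)"
    proof (cases "\<exists>i. k < i \<and> i < n \<and> w $ i \<noteq> 0")
      case True
      then obtain i where i: "k < i" "i < n" "w $ i \<noteq> 0" by blast
      have z: "w $ l = 0" if "k \<le> l" "l < n" "l \<noteq> i" for l
      proof (rule ccontr)
        assume "w $ l \<noteq> 0"
        with False that i show False by (metis less_imp_le linear)
      qed
      \<comment> \<open>Two additions replace a swap: position \<open>k\<close> holds
        \<open>0\<close>, so it first receives the entry from \<open>i\<close>, which is then
        subtracted at \<open>i\<close>.\<close>
      define x where "x = addrow_mat n 1 k i *\<^sub>v w"
      have x: "x $ l = (if l = k then w $ i else w $ l)" if "l < n" for l
        using addrow_mat_mult_vec[OF less.prems that, of k i 1] z[of k] i assms(2) by (auto simp: x_def)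
      have xe: "row_equiv n k w x" unfolding x_def using less.prems i by (intro row_equiv_addrow) auto
      note xc = row_equiv_carrier(2)[OF xe]
      define y where "y = addrow_mat n (- 1) i k *\<^sub>v x"
      have y: "y $ l = (if l = i then 0 else x $ l)" if "l < n" for l
        using addrow_mat_mult_vec[OF xc that, of i k "-1"] x i assms(2) by (auto simp: y_def)
      have ye: "row_equiv n k x y" unfolding y_def using xc i by (intro row_equiv_addrow) auto
      have "row_equiv n k w y" using row_equiv_trans[OF xe ye] assms(2) by simp
      moreover have "y $ l = 0" if "k < l" "l < n" for l using y[of l] x[of l] z[of l] that by auto
      ultimately show ?thesis by blast
    qed (use row_equiv_refl less.prems assms(2) in \<open>auto intro!: exI[of _ w]\<close>)
    then obtain y where y: "row_equiv n k w y" "\<forall>i. k < i \<longrightarrow> i < n \<longrightarrow> y $ i = 0" by blast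
    note yc = row_equiv_carrier(2)[OF y(1)]
    show ?thesis
    proof (cases "0 \<le> y $ k")
      case False
      have "row_equiv n k y (multrow_mat n k (- 1) *\<^sub>v y)"
        using yc assms(2) by (intro row_equiv_uminus) auto
      then have "row_equiv n k w (multrow_mat n k (- 1) *\<^sub>v y)"
        using row_equiv_trans[OF y(1)] assms(2) by simp
      with False show ?thesis
        using multrow_mat_mult_vec[OF yc, of _ k "-1"] y(2) assms(2)
        by (intro exI[of _ "multrow_mat n k (- 1) *\<^sub>v y"]) auto
    qed (use y in blast)
  qed
qed

text \<open>Reduction with \<open>k = 0\<close> leaves a nonnegative common divisor of the entries
  of \<open>v\<close>, which must be \<open>1\<close>. So some unimodular \<open>S\<close> sends
  \<open>v\<close> to the first unit vector, the inverse of \<open>S\<close> has \<open>v\<close> as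
  first column, and its transpose has \<open>v\<close> as first row.\<close>

lemma unimodular_row_exists:
  assumes "primitive_vec n v" "0 < n"
  obtains P where "unimodular n P" "row P 0 = v"
proof -
  have vc: "v \<in> carrier_vec n" using assms by (simp add: primitive_vec_def)
  from row_equiv_reduce[OF vc assms(2)] obtain w where
    w: "row_equiv n 0 v w" "0 \<le> w $ 0" "\<forall>i. 0 < i \<longrightarrow> i < n \<longrightarrow> w $ i = 0" by blast
  have "\<forall>i\<in>{0..<n}. w $ 0 dvd w $ i" using w(3) by (metis atLeastLessThan_iff dvd_0_right dvd_refl neq0_conv)
  then have "\<forall>i\<in>{0..<n}. w $ 0 dvd v $ i" using w(1) unfolding row_equiv_def by blast
  then have "w $ 0 dvd 1" using assms(1) by (auto simp: primitive_vec_def)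
  with w(2) have w0: "w $ 0 = 1" by auto
  have w_eq: "w = unit_vec n 0"
    using w0 w(3) row_equiv_carrier(2)[OF w(1)] by (intro eq_vecI) (auto simp: unit_vec_def)
  obtain S where S: "unimodular n S" "w = S *\<^sub>v v" using w(1) unfolding row_equiv_def by blast
  obtain V where V: "S \<in> carrier_mat n n" "V \<in> carrier_mat n n" "S * V = 1\<^sub>m n" "V * S = 1\<^sub>m n"
    using S(1) unfolding unimodular_def by blast
  have "col V 0 = V *\<^sub>v unit_vec n 0"
    using V assms(2) by (intro eq_vecI) auto
  also have "\<dots> = (V * S) *\<^sub>v v"
    using assoc_mult_mat_vec[OF V(2,1) vc] S(2) w_eq by simp
  also have "\<dots> = v" using V vc by simp
  finally have "row (transpose_mat V) 0 = v" using V assms(2) by simp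
  moreover have "unimodular n (transpose_mat V)"
    using V by (intro unimodular_transpose unimodularI[of V n S])
  ultimately show ?thesis using that by blast
qed

section \<open>Pairs of primitive vectors under unimodular matrices\<close>

lemma unimodular_primitive:
  assumes "unimodular n U" "primitive_vec n w"
  shows "primitive_vec n (U *\<^sub>v w)"
  unfolding primitive_vec_def
proof (intro conjI allI impI)
  obtain V where V: "U \<in> carrier_mat n n" "V \<in> carrier_mat n n" "V * U = 1\<^sub>m n"
    using assms unfolding unimodular_def by blast
  have w: "w \<in> carrier_vec n" using assms by (simp add: primitive_vec_def)
  show "U *\<^sub>v w \<in> carrier_vec n" using V w by auto
  fix c assume c: "\<forall>i<n. c dvd (U *\<^sub>v w) $ i"
  have "w = V *\<^sub>v (U *\<^sub>v w)"
    using V w by (simp add: assoc_mult_mat_vec[of _ n n _ n, symmetric])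
  moreover have "c dvd (V *\<^sub>v (U *\<^sub>v w)) $ i" if "i < n" for i
    using that V w c by (auto simp: scalar_prod_def simp del: index_mult_mat_vec(1) simp add: index_mult_mat_vec(1)[of i V] intro!: dvd_sum)
  ultimately have "\<forall>i<n. c dvd w $ i" by metis
  then show "c dvd 1" using assms(2) by (simp add: primitive_vec_def)
qed

text \<open>If \<open>v\<close> is row 0 of \<open>U\<close>, then coordinate 0 of
  \<open>U *\<^sub>v w\<close> is forced to be \<open>v \<bullet> w\<close>. The \<open>1\<close>
  next to it makes the vector primitive whatever \<open>d\<close> is.\<close>

definition pair_normal_form :: "nat \<Rightarrow> int \<Rightarrow> int vec" where
  "pair_normal_form n d = vec n (\<lambda>i. if i = 0 then d else if i = 1 then 1 else 0)"

text \<open>Adding the coordinate \<open>0\<close>, with value \<open>d\<close>, to the free third coordinate makes the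
  coordinates below \<open>0\<close> coprime without changing the linear form; this needs \<open>n \<ge> 3\<close>.\<close>

lemma unimodular_pair_normal_form:
  assumes v: "primitive_vec n v" and w: "primitive_vec n w" and n: "3 \<le> n"
  obtains U where "unimodular n U" "row U 0 = v" "U *\<^sub>v w = pair_normal_form n (v \<bullet> w)"
proof -
  define d where "d = v \<bullet> w"
  obtain P where P: "unimodular n P" "row P 0 = v" using unimodular_row_exists[OF v] n by auto
  have Pc: "P \<in> carrier_mat n n" and wc: "w \<in> carrier_vec n"
    using P w by (auto simp: unimodular_def primitive_vec_def)
  define w1 where "w1 = P *\<^sub>v w"
  have w1: "primitive_vec n w1" unfolding w1_def using P(1) w by (rule unimodular_primitive)
  then have w1c: "w1 \<in> carrier_vec n" by (simp add: primitive_vec_def)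
  have w10: "w1 $ 0 = d" using P Pc n by (simp add: w1_def d_def)
  \<comment> \<open>Reducing only from coordinate 1 on keeps row 0 equal to \<open>v\<close> and
    frees coordinate 2, which becomes \<open>0\<close>.\<close>
  obtain w2 where w2: "row_equiv n 1 w1 w2" "\<forall>i. 1 < i \<longrightarrow> i < n \<longrightarrow> w2 $ i = 0"
    using row_equiv_reduce[OF w1c, of 1] n by auto
  obtain W where W: "unimodular n W" "fixes_coords n 1 W" "w2 = W *\<^sub>v w1"
    using w2(1) unfolding row_equiv_def by blast
  have Wc: "W \<in> carrier_mat n n" by (rule unimodular_carrier[OF W(1)])
  have w2p: "primitive_vec n w2" using W w1 by (simp add: unimodular_primitive)
  have w2c: "w2 \<in> carrier_vec n" using w2p by (simp add: primitive_vec_def)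
  have w20: "w2 $ 0 = d" using fixes_coords_mult_vec[OF W(2) _ w1c, of 0] Wc W(3) w10 n by simp
  define E where "E = addrow_mat n (1::int) 2 0"
  have E: "unimodular n E" "fixes_coords n 1 E"
    unfolding E_def using n by (auto intro!: unimodular_addrow_mat fixes_coords_addrow_mat)
  have Ec: "E \<in> carrier_mat n n" by (rule unimodular_carrier[OF E(1)])
  define w3 where "w3 = E *\<^sub>v w2"
  have w3: "w3 $ i = (if i = 2 then d + w2 $ 2 else w2 $ i)" if "i < n" for i
    using addrow_mat_mult_vec[OF w2c that, of 2 0 1] n w20 by (simp add: w3_def E_def)
  have w3c: "w3 \<in> carrier_vec n" unfolding w3_def using Ec w2c by simp
  obtain w4 where w4: "row_equiv n 1 w3 w4" "0 \<le> w4 $ 1" "\<forall>i. 1 < i \<longrightarrow> i < n \<longrightarrow> w4 $ i = 0"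
    using row_equiv_reduce[OF w3c, of 1] n by auto
  obtain X where X: "unimodular n X" "fixes_coords n 1 X" "w4 = X *\<^sub>v w3"
    using w4(1) unfolding row_equiv_def by blast
  have Xc: "X \<in> carrier_mat n n" by (rule unimodular_carrier[OF X(1)])
  have w40: "w4 $ 0 = d" using fixes_coords_mult_vec[OF X(2) Xc w3c, of 0] X(3) w3[of 0] w20 n by simp
  have "\<forall>i\<in>{1..<n}. w4 $ 1 dvd w4 $ i"
    using w4(3) by (metis One_nat_def atLeastLessThan_iff dvd_0_right dvd_refl le_neq_implies_less)
  then have dv: "\<forall>i\<in>{1..<n}. w4 $ 1 dvd w3 $ i" using w4(1) unfolding row_equiv_def by blast
  \<comment> \<open>Since \<open>w2 $ 2 = 0\<close>, the entry \<open>w3 $ 2\<close> is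
    \<open>d\<close> itself. So \<open>w4 $ 1\<close> divides every entry of the primitive vector
    \<open>w2\<close> and must be \<open>1\<close>.\<close>
  have "w4 $ 1 dvd w3 $ 2" "w4 $ 1 dvd w3 $ 1" using dv n by auto
  then have a: "w4 $ 1 dvd d" "w4 $ 1 dvd w2 $ 1" using w3[of 1] w3[of 2] w2(2) n by auto
  have "w4 $ 1 dvd w2 $ i" if "i < n" for i
  proof -
    consider "i = 0" | "i = 1" | "1 < i" by linarith
    then show ?thesis using a w20 w2(2) that by cases auto
  qed
  then have "w4 $ 1 dvd 1" using w2p by (simp add: primitive_vec_def)
  then have w41: "w4 $ 1 = 1" using w4(2) by auto
  have w4c: "w4 \<in> carrier_vec n" by (rule row_equiv_carrier(2)[OF w4(1)])
  have w4nf: "w4 = pair_normal_form n d"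
    using w4c w40 w41 w4(3) n unfolding pair_normal_form_def
    by (intro eq_vecI) (auto simp: less_Suc_eq_0_disj dest: gr0_conv_Suc[THEN iffD1])
  define Y where "Y = X * (E * W)"
  have Yc: "Y \<in> carrier_mat n n" using Xc Ec Wc by (simp add: Y_def)
  have Y: "unimodular n Y" "fixes_coords n 1 Y"
    unfolding Y_def using X E W Xc Ec Wc n by (auto intro!: unimodular_mult fixes_coords_mult mult_carrier_mat)
  have "row (Y * P) 0 = v"
  proof (rule eq_vecI)
    fix j assume j: "j < dim_vec v"
    have vn: "dim_vec v = n" using v by (auto simp: primitive_vec_def)
    have "row (Y * P) 0 $ j = row Y 0 \<bullet> col P j" using Yc Pc j vn n by simp
    also have "\<dots> = unit_vec n 0 \<bullet> col P j" using Y by (simp add: fixes_coords_def)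
    also have "\<dots> = row P 0 $ j" using Pc j vn n by simp
    finally show "row (Y * P) 0 $ j = v $ j" using P by simp
  qed (use v Pc in \<open>auto simp: primitive_vec_def\<close>)
  moreover have "(Y * P) *\<^sub>v w = pair_normal_form n d"
    using Yc Xc Ec Wc Pc wc w1c w2c w3c unfolding w4nf[symmetric] X(3) w3_def W(3) w1_def Y_def
    by (simp add: assoc_mult_mat_vec[of _ n n _ n])
  ultimately show ?thesis using that[of "Y * P"] unimodular_mult[OF Y(1) P(1)] by (simp add: d_def)
qed

text \<open>Matrices \<open>P\<close> and \<open>Q\<close> bring both pairs to the same normal form,
  and \<open>U\<close> is the inverse of \<open>Q\<close> times \<open>P\<close>.\<close>

lemma unimodular_pairs_transitive:
  assumes "primitive_vec n v" "primitive_vec n w" "primitive_vec n v'" "primitive_vec n w'"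
    and "v \<bullet> w = v' \<bullet> w'" "3 \<le> n"
  obtains U V where "U \<in> carrier_mat n n" "V \<in> carrier_mat n n" "U * V = 1\<^sub>m n" "V * U = 1\<^sub>m n"
    "U *\<^sub>v w = w'" "transpose_mat U *\<^sub>v v' = v"
proof -
  obtain P where P: "unimodular n P" "row P 0 = v" "P *\<^sub>v w = pair_normal_form n (v \<bullet> w)"
    using unimodular_pair_normal_form assms by blast
  obtain Q where Q: "unimodular n Q" "row Q 0 = v'" "Q *\<^sub>v w' = pair_normal_form n (v' \<bullet> w')"
    using unimodular_pair_normal_form assms by blast
  obtain P' where P': "P \<in> carrier_mat n n" "P' \<in> carrier_mat n n" "P * P' = 1\<^sub>m n" "P' * P = 1\<^sub>m n"
    using P unfolding unimodular_def by blast
  obtain Q' where Q': "Q \<in> carrier_mat n n" "Q' \<in> carrier_mat n n" "Q * Q' = 1\<^sub>m n" "Q' * Q = 1\<^sub>m n"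
    using Q unfolding unimodular_def by blast
  have c: "v \<in> carrier_vec n" "w \<in> carrier_vec n" "v' \<in> carrier_vec n" "w' \<in> carrier_vec n"
    using assms by (auto simp: primitive_vec_def)
  have "Q' * P *\<^sub>v w = Q' *\<^sub>v (Q *\<^sub>v w')"
    using P Q P' Q' c assms(5) by (simp add: assoc_mult_mat_vec[of _ n n _ n])
  also have "\<dots> = w'" using Q' c by (simp add: assoc_mult_mat_vec[of _ n n _ n, symmetric])
  finally have 1: "Q' * P *\<^sub>v w = w'" .
  \<comment> \<open>Rows 0 become images of the first unit vector under transposes, so that
    \<open>Q\<close> and its inverse cancel in the image of \<open>v'\<close>.\<close>
  have rowT: "transpose_mat M *\<^sub>v unit_vec n 0 = row M 0" if "M \<in> carrier_mat n n" for M :: "int mat"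
    using that assms(6) by (intro eq_vecI) auto
  have "transpose_mat (Q' * P) *\<^sub>v v' = transpose_mat P *\<^sub>v (transpose_mat Q' *\<^sub>v (transpose_mat Q *\<^sub>v unit_vec n 0))"
    using P' Q' Q(2) rowT[of Q] by (simp add: transpose_mult[of _ n n _ n] assoc_mult_mat_vec[of _ n n _ n] c)
  also have "transpose_mat Q' *\<^sub>v (transpose_mat Q *\<^sub>v unit_vec n 0) = transpose_mat (Q * Q') *\<^sub>v unit_vec n 0"
    unfolding transpose_mult[OF Q'(1,2)] using Q' by (simp add: assoc_mult_mat_vec[of _ n n _ n])
  also have "transpose_mat P *\<^sub>v \<dots> = v" using Q'(3) rowT[OF P'(1)] P(2) by simp
  finally have 2: "transpose_mat (Q' * P) *\<^sub>v v' = v" .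
  have "P * (P' * Q) = Q" "Q * (Q' * P) = P"
    using P' Q' by (simp_all add: assoc_mult_mat[of _ n n _ n _ n, symmetric])
  then have a: "Q' * P * (P' * Q) = 1\<^sub>m n" "P' * Q * (Q' * P) = 1\<^sub>m n"
    using P' Q' by (simp_all add: assoc_mult_mat[of _ n n _ n _ n])
  show ?thesis
    by (rule that[of "Q' * P" "P' * Q"]) (use P' Q' 1 2 a in auto)
qed

section \<open>Matrix powers, eigenvectors and iteration of positive matrices\<close>

lemma pow_mat_Suc_left:
  assumes "A \<in> carrier_mat n n"
  shows "A ^\<^sub>m Suc k = A * A ^\<^sub>m k"
proof (induction k)
  case (Suc k)
  then show ?case using assms by (simp add: assoc_mult_mat[of A n n "A ^\<^sub>m k" n A n])
qed (use assms in simp)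

lemma pow_mat_add:
  assumes "A \<in> carrier_mat n n"
  shows "A ^\<^sub>m (j + k) = A ^\<^sub>m j * A ^\<^sub>m k"
proof (induction k)
  case (Suc k)
  then show ?case using assms by (simp add: assoc_mult_mat[of "A ^\<^sub>m j" n n "A ^\<^sub>m k" n A n])
qed (use assms in simp)

lemma pow_mat_mult:
  assumes "A \<in> carrier_mat n n"
  shows "A ^\<^sub>m (j * k) = (A ^\<^sub>m j) ^\<^sub>m k"
proof (induction k)
  case (Suc k)
  have "A ^\<^sub>m (j * Suc k) = A ^\<^sub>m (j * k + j)" by (simp add: add.commute)
  also have "\<dots> = (A ^\<^sub>m j) ^\<^sub>m k * A ^\<^sub>m j" by (simp add: pow_mat_add[OF assms] Suc)
  finally show ?case by simp
qed (use assms in simp)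

lemma pow_mat_right_inverse:
  assumes "A \<in> carrier_mat n n" "B \<in> carrier_mat n n" "A * B = 1\<^sub>m n"
  shows "A ^\<^sub>m k * B ^\<^sub>m k = 1\<^sub>m n"
proof (induction k)
  case (Suc k)
  have "A * (B * B ^\<^sub>m k) = B ^\<^sub>m k"
    using assms by (simp add: assoc_mult_mat[of A n n B n "B ^\<^sub>m k" n, symmetric])
  then have "A ^\<^sub>m k * A * (B * B ^\<^sub>m k) = A ^\<^sub>m k * B ^\<^sub>m k"
    using assms by (simp add: assoc_mult_mat[of "A ^\<^sub>m k" n n A n _ n])
  then show ?case using Suc assms by (simp add: pow_mat_Suc_left[OF assms(2), simplified])
qed (use assms in simp)

lemma mult_mat_vec_smult:
  fixes A :: "'a :: comm_ring_1 mat"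
  assumes "A \<in> carrier_mat n m" "x \<in> carrier_vec m"
  shows "A *\<^sub>v (c \<cdot>\<^sub>v x) = c \<cdot>\<^sub>v (A *\<^sub>v x)"
  using assms by (intro eq_vecI) (auto simp: scalar_prod_smult_distrib[of _ m])

lemma pow_mat_eigenvector:
  fixes A :: "'a :: comm_ring_1 mat"
  assumes "A \<in> carrier_mat n n" "w \<in> carrier_vec n" "A *\<^sub>v w = l \<cdot>\<^sub>v w"
  shows "A ^\<^sub>m k *\<^sub>v w = l ^ k \<cdot>\<^sub>v w"
proof (induction k)
  case (Suc k)
  have "A ^\<^sub>m Suc k *\<^sub>v w = A ^\<^sub>m k *\<^sub>v (A *\<^sub>v w)"
    using assms by (simp add: assoc_mult_mat_vec[of _ n n _ n])
  also have "\<dots> = l \<cdot>\<^sub>v (A ^\<^sub>m k *\<^sub>v w)"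
    unfolding assms(3) by (rule mult_mat_vec_smult[OF pow_carrier_mat[OF assms(1)] assms(2)])
  finally show ?case by (simp add: Suc smult_smult_assoc)
qed (use assms in simp)

lemma pow_mat_left_eigenvector:
  fixes A :: "'a :: comm_ring_1 mat"
  assumes "A \<in> carrier_mat n n" "v \<in> carrier_vec n" "transpose_mat A *\<^sub>v v = l \<cdot>\<^sub>v v"
    and "x \<in> carrier_vec n"
  shows "v \<bullet> (A ^\<^sub>m k *\<^sub>v x) = l ^ k * (v \<bullet> x)"
proof (induction k)
  case (Suc k)
  have "v \<bullet> (A ^\<^sub>m Suc k *\<^sub>v x) = v \<bullet> (A *\<^sub>v (A ^\<^sub>m k *\<^sub>v x))"
    unfolding pow_mat_Suc_left[OF assms(1)]
    using assms by (simp add: assoc_mult_mat_vec[of _ n n _ n])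
  also have "\<dots> = (transpose_mat A *\<^sub>v v) \<bullet> (A ^\<^sub>m k *\<^sub>v x)"
    by (rule transpose_vec_mult_scalar[OF assms(1) _ assms(2), symmetric])
      (rule mult_mat_vec_carrier[OF pow_carrier_mat[OF assms(1)] assms(4)])
  also have "\<dots> = l * (v \<bullet> (A ^\<^sub>m k *\<^sub>v x))"
    using assms by (simp add: smult_scalar_prod_distrib[of _ n])
  finally show ?case using Suc by simp
qed (use assms in simp)

text \<open>Pairing with unit vectors reads off the coordinates, which reduces the claim to the
  scalar product version.\<close>

lemma transpose_pow_mat_eigenvector:
  fixes A :: "'a :: comm_ring_1 mat"
  assumes "A \<in> carrier_mat n n" "v \<in> carrier_vec n" "transpose_mat A *\<^sub>v v = l \<cdot>\<^sub>v v"
  shows "transpose_mat (A ^\<^sub>m k) *\<^sub>v v = l ^ k \<cdot>\<^sub>v v"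
proof (rule eq_vecI)
  note c = pow_carrier_mat[OF assms(1), of k]
  fix j assume "j < dim_vec (l ^ k \<cdot>\<^sub>v v)"
  then have j: "j < n" using assms(2) by simp
  have "(transpose_mat (A ^\<^sub>m k) *\<^sub>v v) $ j = (transpose_mat (A ^\<^sub>m k) *\<^sub>v v) \<bullet> unit_vec n j"
    using c j assms(2) by (simp add: scalar_prod_right_unit[of _ n])
  also have "\<dots> = v \<bullet> (A ^\<^sub>m k *\<^sub>v unit_vec n j)"
    by (rule transpose_vec_mult_scalar[OF c _ assms(2)]) simp
  also have "\<dots> = (l ^ k \<cdot>\<^sub>v v) $ j"
    using pow_mat_left_eigenvector[OF assms, of "unit_vec n j" k] j assms(2) by simp
  finally show "(transpose_mat (A ^\<^sub>m k) *\<^sub>v v) $ j = (l ^ k \<cdot>\<^sub>v v) $ j" .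
qed (use assms in simp)

text \<open>If \<open>y \<ge> s w\<close>, then positivity of \<open>P\<close> applied to \<open>y - s w \<ge> 0\<close> improves the lower
  bound by a fixed proportion \<open>\<epsilon>\<close> of the gap to the asymptotic value \<open>\<langle>v, y\<rangle> / \<langle>v, w\<rangle>\<close>.\<close>

lemma positive_mat_contraction:
  fixes P :: "real mat"
  assumes P: "P \<in> carrier_mat n n" and w: "w \<in> carrier_vec n" "P *\<^sub>v w = \<mu> \<cdot>\<^sub>v w"
    and v: "v \<in> carrier_vec n" and y: "y \<in> carrier_vec n"
    and e: "\<And>i j. i < n \<Longrightarrow> j < n \<Longrightarrow> e * w $ i * v $ j \<le> P $$ (i,j)"
    and le: "\<And>i. i < n \<Longrightarrow> s * w $ i \<le> y $ i" and i: "i < n"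
  shows "(\<mu> * s + e * (v \<bullet> y - s * (v \<bullet> w))) * w $ i \<le> (P *\<^sub>v y) $ i"
proof -
  define u where "u = y - s \<cdot>\<^sub>v w"
  have u: "u \<in> carrier_vec n" using y w by (simp add: u_def)
  have y_eq: "y = s \<cdot>\<^sub>v w + u" unfolding u_def using y w by (intro eq_vecI) auto
  have vu: "v \<bullet> u = v \<bullet> y - s * (v \<bullet> w)"
    using v w y by (simp add: u_def scalar_prod_minus_distrib[of _ n])
  have "(P *\<^sub>v y) $ i = (s \<cdot>\<^sub>v (P *\<^sub>v w) + P *\<^sub>v u) $ i"
    unfolding y_eq using P w(1) u by (simp add: mult_add_distrib_mat_vec[of _ n n] mult_mat_vec[of _ n n])
  also have "\<dots> = s * \<mu> * w $ i + (P *\<^sub>v u) $ i" using P w u i by simp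
  finally have 1: "(P *\<^sub>v y) $ i = s * \<mu> * w $ i + (P *\<^sub>v u) $ i" .
  have "e * w $ i * (v \<bullet> u) = (\<Sum>j<n. (e * w $ i * v $ j) * u $ j)"
    using u by (simp add: scalar_prod_def sum_distrib_left mult.assoc lessThan_atLeast0)
  also have "\<dots> \<le> (\<Sum>j<n. P $$ (i,j) * u $ j)"
    using e i le y w by (intro sum_mono mult_right_mono) (auto simp: u_def)
  also have "\<dots> = (P *\<^sub>v u) $ i"
    using P i u by (auto simp: scalar_prod_def lessThan_atLeast0)
  finally show ?thesis unfolding 1 vu by (simp add: algebra_simps)
qed

text \<open>Iterating the contraction gives lower bounds for
  \<open>P ^\<^sub>m m *\<^sub>v z\<close> relative to \<open>w\<close>. Divided by
  \<open>\<mu> ^ m\<close>, they tend to \<open>v \<bullet> z / (v \<bullet> w) > 0\<close>.\<close>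

lemma positive_mat_eventually_nonneg:
  fixes P :: "real mat"
  assumes P: "P \<in> carrier_mat n n" and pos: "\<And>i j. i < n \<Longrightarrow> j < n \<Longrightarrow> 1 \<le> P $$ (i,j)"
    and w: "w \<in> carrier_vec n" "P *\<^sub>v w = \<mu> \<cdot>\<^sub>v w" "\<And>i. i < n \<Longrightarrow> 0 < w $ i"
    and v: "v \<in> carrier_vec n" "transpose_mat P *\<^sub>v v = \<mu> \<cdot>\<^sub>v v" "\<And>i. i < n \<Longrightarrow> 0 < v $ i"
    and z: "z \<in> carrier_vec n" "0 < v \<bullet> z" and mu: "0 < \<mu>"
  shows "\<exists>m. \<forall>i<n. 0 \<le> (P ^\<^sub>m m *\<^sub>v z) $ i"
proof -
  have n: "0 < n" using z v(1) by (cases n) (auto simp: scalar_prod_def)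
  define d where "d = v \<bullet> w"
  define sv where "sv = (\<Sum>i<n. v $ i)"
  define sw where "sw = (\<Sum>i<n. w $ i)"
  have d: "0 < d" unfolding d_def scalar_prod_def using v w n by (intro sum_pos) auto
  have "0 < sv" unfolding sv_def using v n by (intro sum_pos) auto
  moreover have "v $ i \<le> sv" if "i < n" for i
    unfolding sv_def using v that by (intro member_le_sum) (auto intro: less_imp_le)
  ultimately have sv: "0 < sv" "\<And>i. i < n \<Longrightarrow> v $ i \<le> sv" by auto
  have "0 < sw" unfolding sw_def using w n by (intro sum_pos) auto
  moreover have "w $ i \<le> sw" if "i < n" for i
    unfolding sw_def using w that by (intro member_le_sum) (auto intro: less_imp_le)
  ultimately have sw: "0 < sw" "\<And>i. i < n \<Longrightarrow> w $ i \<le> sw" by auto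
  \<comment> \<open>Small enough that \<open>e * \<mu> / d * w $ i * v $ j \<le> 1\<close>, so that
    \<open>e * \<mu> / d\<close> can serve as the constant of the contraction lemma.\<close>
  define e where "e = min (1/2) (d / (\<mu> * sw * sv))"
  have e: "0 < e" "e < 1" "e \<le> d / (\<mu> * sw * sv)"
    unfolding e_def using d mu sv sw by auto
  have e_le: "e * \<mu> / d * w $ i * v $ j \<le> P $$ (i,j)" if "i < n" "j < n" for i j
  proof -
    have "w $ i * v $ j \<le> sw * sv" using sw sv v w that by (intro mult_mono) (auto intro: less_imp_le)
    then have "e * \<mu> / d * (w $ i * v $ j) \<le> e * \<mu> / d * (sw * sv)"
      using e mu d by (intro mult_left_mono) auto
    also have "\<dots> \<le> 1" using e(3) mu d sv sw by (simp add: field_simps)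
    finally show ?thesis using pos[OF that] by (simp add: mult.assoc)
  qed
  define c where "c = (v \<bullet> z) / d"
  have c: "0 < c" "v \<bullet> z = c * d" using z d by (auto simp: c_def)
  \<comment> \<open>An initial gap so large that \<open>c - D\<close> is at most every
    \<open>z $ i / w $ i\<close>; the summand \<open>c\<close> makes it positive.\<close>
  define D where "D = c + (\<Sum>i<n. \<bar>z $ i\<bar> / w $ i)"
  have D0: "0 < D" unfolding D_def using c w by (intro add_pos_nonneg sum_nonneg divide_nonneg_pos) auto
  have start: "(c - D) * w $ i \<le> z $ i" if "i < n" for i
  proof -
    have "\<bar>z $ i\<bar> / w $ i \<le> (\<Sum>i<n. \<bar>z $ i\<bar> / w $ i)"
      using w that by (intro member_le_sum divide_nonneg_pos) auto
    then have "\<bar>z $ i\<bar> \<le> (D - c) * w $ i" using w(3)[OF that] by (simp add: D_def field_simps)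
    then show ?thesis by (simp add: algebra_simps)
  qed
  have bound: "\<mu> ^ m * (c - (1 - e) ^ m * D) * w $ i \<le> (P ^\<^sub>m m *\<^sub>v z) $ i" if "i < n" for m i
    using that
  proof (induction m arbitrary: i)
    case 0
    then show ?case using start P z by simp
  next
    case (Suc m)
    define s where "s = \<mu> ^ m * (c - (1 - e) ^ m * D)"
    define y where "y = P ^\<^sub>m m *\<^sub>v z"
    have y: "y \<in> carrier_vec n" 
      unfolding y_def by (rule mult_mat_vec_carrier[OF pow_carrier_mat[OF P] z(1)])
    have vy: "v \<bullet> y = \<mu> ^ m * c * d"
      unfolding y_def using pow_mat_left_eigenvector[OF P v(1,2) z(1)] c by simp
    have "(\<mu> * s + e * \<mu> / d * (v \<bullet> y - s * d)) * w $ i \<le> (P *\<^sub>v y) $ i"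
      unfolding d_def
      by (rule positive_mat_contraction[OF P w(1,2) v(1) y]) (use e_le Suc in \<open>auto simp: s_def y_def d_def\<close>)
    \<comment> \<open>The gap in \<open>y\<close> is \<open>\<mu> ^ m * (1 - e) ^ m * D * d\<close>;
      a proportion \<open>e\<close> of it is gained, hence one more factor
      \<open>1 - e\<close>.\<close>
    moreover have "\<mu> * s + e * \<mu> / d * (v \<bullet> y - s * d) = \<mu> ^ Suc m * (c - (1 - e) ^ Suc m * D)"
      unfolding vy s_def using d by (simp add: field_simps)
    moreover have "P *\<^sub>v y = P ^\<^sub>m Suc m *\<^sub>v z"
      unfolding pow_mat_Suc_left[OF P] y_def using P z by (simp add: assoc_mult_mat_vec[of _ n n _ n])
    ultimately show ?case by simp
  qed
  obtain m where m: "(1 - e) ^ m < c / D" using real_arch_pow_inv[of "c / D" "1 - e"] c D0 e by auto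
  then have "(1 - e) ^ m * D \<le> c" using D0 by (simp add: field_simps)
  then have "0 \<le> \<mu> ^ m * (c - (1 - e) ^ m * D) * w $ i" if "i < n" for i
    using mu w(3)[OF that] by simp
  then show ?thesis using bound order_trans by blast
qed

section \<open>Membership in the dimension group and its cone\<close>

abbreviation rmat :: "int mat \<Rightarrow> rat mat" where "rmat \<equiv> map_mat rat_of_int"
abbreviation rvec :: "int vec \<Rightarrow> rat vec" where "rvec \<equiv> map_vec rat_of_int"

lemma of_int_scalar_prod:
  assumes "x \<in> carrier_vec n" "y \<in> carrier_vec n"
  shows "map_vec of_int x \<bullet> map_vec of_int y = (of_int (x \<bullet> y) :: 'a :: ring_1)"
  using assms by (simp add: scalar_prod_def)

lemma rat_inverse:
  assumes "A \<in> carrier_mat n n" "det A \<noteq> 0"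
  shows "rat_inverse A \<in> carrier_mat n n" "rmat A * rat_inverse A = 1\<^sub>m n"
    "rat_inverse A * rmat A = 1\<^sub>m n"
proof -
  have A: "rmat A \<in> carrier_mat n n" using assms by simp
  have "det (rmat A) \<noteq> 0" using assms by simp
  then have "rmat A \<in> Units (ring_mat TYPE(rat) n ())" by (rule det_non_zero_imp_unit[OF A])
  then obtain B where "mat_inverse (rmat A) = Some B" using mat_inverse(1)[OF A] by fastforce
  with mat_inverse(2)[OF A this]
  show "rat_inverse A \<in> carrier_mat n n" "rmat A * rat_inverse A = 1\<^sub>m n"
    "rat_inverse A * rmat A = 1\<^sub>m n" by (auto simp: rat_inverse_def)
qed

text \<open>Moving the inverse to the other side turns membership into the condition that some
  \<open>A ^\<^sub>m k\<close> makes \<open>x\<close> integral, so only powers of the integer matrix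
  occur later.\<close>

lemma rat_inverse_pow_eq_iff:
  assumes "A \<in> carrier_mat n n" "det A \<noteq> 0" "y \<in> carrier_vec n"
  shows "x = (rat_inverse A ^\<^sub>m k) *\<^sub>v y \<longleftrightarrow> x \<in> carrier_vec n \<and> rmat (A ^\<^sub>m k) *\<^sub>v x = y"
proof -
  note R = rat_inverse[OF assms(1,2)]
  have A: "rmat A \<in> carrier_mat n n" using assms by simp
  have pow: "rmat (A ^\<^sub>m k) = rmat A ^\<^sub>m k" by (rule of_int_hom.mat_hom_pow[OF assms(1)])
  note i = pow_mat_right_inverse[OF A R(1,2), of k] pow_mat_right_inverse[OF R(1) A R(3), of k]
  note c = pow_carrier_mat[OF A, of k] pow_carrier_mat[OF R(1), of k]
  show ?thesis unfolding pow
  proof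
    assume x: "x = (rat_inverse A ^\<^sub>m k) *\<^sub>v y"
    show "x \<in> carrier_vec n \<and> rmat A ^\<^sub>m k *\<^sub>v x = y"
      unfolding x using c i assms(3) assoc_mult_mat_vec[OF c(1,2) assms(3)] by simp
  next
    assume x: "x \<in> carrier_vec n \<and> rmat A ^\<^sub>m k *\<^sub>v x = y"
    then show "x = (rat_inverse A ^\<^sub>m k) *\<^sub>v y"
      using c i assoc_mult_mat_vec[OF c(2,1), of x] by auto
  qed
qed

lemma mem_dim_group_carrier_iff:
  assumes "A \<in> carrier_mat n n" "det A \<noteq> 0"
  shows "x \<in> dim_group_carrier A \<longleftrightarrow>
    x \<in> carrier_vec n \<and> (\<exists>k. \<exists>z\<in>carrier_vec n. rmat (A ^\<^sub>m k) *\<^sub>v x = rvec z)"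
  using rat_inverse_pow_eq_iff[OF assms, of "rvec _" x] assms
  unfolding dim_group_carrier_def by auto

lemma mem_dim_group_cone_iff:
  assumes "A \<in> carrier_mat n n" "det A \<noteq> 0"
  shows "x \<in> dim_group_cone A \<longleftrightarrow>
    x \<in> carrier_vec n \<and> (\<exists>k. \<exists>z\<in>carrier_vec n. (\<forall>i<n. 0 \<le> z $ i) \<and> rmat (A ^\<^sub>m k) *\<^sub>v x = rvec z)"
  using rat_inverse_pow_eq_iff[OF assms, of "rvec _" x] assms
  unfolding dim_group_cone_def by auto

lemma rvec_mult:
  assumes "A \<in> carrier_mat n n" "x \<in> carrier_vec n"
  shows "rvec (A *\<^sub>v x) = rmat A *\<^sub>v rvec x"
  by (rule of_int_hom.mult_mat_vec_hom[OF assms])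

section \<open>The dimension group of one matrix in terms of its Perron data\<close>

locale integral_perron =
  fixes n :: nat and A :: "int mat" and l :: int and v w :: "int vec"
  assumes A: "A \<in> carrier_mat n n" and prim: "primitive_mat A"
    and l_pos: "0 < l" and det: "l = \<bar>det A\<bar>"
    and v: "primitive_vec n v" "\<And>i. i < n \<Longrightarrow> 0 < v $ i" "transpose_mat A *\<^sub>v v = l \<cdot>\<^sub>v v"
    and w: "primitive_vec n w" "\<And>i. i < n \<Longrightarrow> 0 < w $ i" "A *\<^sub>v w = l \<cdot>\<^sub>v w"
begin

lemma n_pos: "0 < n"
  using v(1) unfolding primitive_vec_def by (cases n) (auto dest: spec[of _ 0])

lemma vc: "v \<in> carrier_vec n" and wc: "w \<in> carrier_vec n"
  using v(1) w(1) by (auto simp: primitive_vec_def)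

lemma det_nonzero: "det A \<noteq> 0"
  using l_pos det by auto

lemma Ak: "A ^\<^sub>m k \<in> carrier_mat n n"
  by (rule pow_carrier_mat[OF A])

lemmas mem_carrier_iff = mem_dim_group_carrier_iff[OF A det_nonzero]
lemmas mem_cone_iff = mem_dim_group_cone_iff[OF A det_nonzero]

lemma inj_rmat_pow:
  assumes "x \<in> carrier_vec n" "y \<in> carrier_vec n" "rmat (A ^\<^sub>m k) *\<^sub>v x = rmat (A ^\<^sub>m k) *\<^sub>v y"
  shows "x = y"
proof -
  have "rmat (A ^\<^sub>m k) *\<^sub>v y \<in> carrier_vec n" using assms(2) Ak[of k] by (auto intro!: mult_mat_vec_carrier)
  from rat_inverse_pow_eq_iff[OF A det_nonzero this, of _ k] assms show ?thesis by metis
qed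

lemma rmat_pow_w: "rmat (A ^\<^sub>m k) *\<^sub>v rvec w = of_int (l ^ k) \<cdot>\<^sub>v rvec w"
  unfolding rvec_mult[OF Ak wc, symmetric] pow_mat_eigenvector[OF A wc w(3)] by (intro eq_vecI) auto

lemma rat_left_eigen: "transpose_mat (rmat A) *\<^sub>v rvec v = of_int l \<cdot>\<^sub>v rvec v"
proof -
  have "transpose_mat (rmat A) = rmat (transpose_mat A)" by (intro eq_matI) auto
  then have "transpose_mat (rmat A) *\<^sub>v rvec v = rvec (transpose_mat A *\<^sub>v v)"
    using rvec_mult[of "transpose_mat A" n v] A vc by simp
  then show ?thesis by (simp add: v(3) of_int_hom.vec_hom_smult)
qed

lemma v_rmat_pow:
  assumes "x \<in> carrier_vec n"
  shows "rvec v \<bullet> (rmat (A ^\<^sub>m k) *\<^sub>v x) = of_int (l ^ k) * (rvec v \<bullet> x)"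
  using pow_mat_left_eigenvector[OF _ _ rat_left_eigen assms, of k] A vc
  by (simp add: of_int_hom.mat_hom_pow[OF A])

text \<open>Completing \<open>v\<close> to a unimodular matrix \<open>S\<close> with first row \<open>v\<close>, the first row of \<open>S A\<close>
  is \<open>l v\<close>, so \<open>S A\<close> is \<open>diag(l, 1, \<dots>, 1)\<close> times a matrix of determinant \<open>\<plusminus>1\<close>.\<close>

lemma mem_range_of_dvd:
  assumes y: "y \<in> carrier_vec n" and dvd: "l dvd v \<bullet> y"
  shows "\<exists>x\<in>carrier_vec n. y = A *\<^sub>v x"
proof -
  obtain S where S: "unimodular n S" "row S 0 = v" using unimodular_row_exists[OF v(1) n_pos] .
  obtain T where T: "S \<in> carrier_mat n n" "T \<in> carrier_mat n n" "S * T = 1\<^sub>m n" "T * S = 1\<^sub>m n"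
    using S unfolding unimodular_def by blast
  \<comment> \<open>This is \<open>S * A\<close> with its first row divided by
    \<open>l\<close>.\<close>
  define C where "C = mat n n (\<lambda>(i,j). if i = 0 then v $ j else (S * A) $$ (i,j))"
  have C: "C \<in> carrier_mat n n" by (simp add: C_def)
  have row0: "row (S * A) 0 = l \<cdot>\<^sub>v v"
  proof (rule eq_vecI)
    fix j assume "j < dim_vec (l \<cdot>\<^sub>v v)"
    then have j: "j < n" using vc by simp
    have "row (S * A) 0 $ j = v \<bullet> col A j" using T A S j n_pos by simp
    also have "\<dots> = (transpose_mat A *\<^sub>v v) $ j" using A j vc by (simp add: comm_scalar_prod[of _ n])
    finally show "row (S * A) 0 $ j = (l \<cdot>\<^sub>v v) $ j" by (simp add: v(3))
  qed (use T A vc in auto)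
  have SA: "S * A = multrow 0 l C"
  proof (rule eq_matI)
    fix i j assume "i < dim_row (multrow 0 l C)" "j < dim_col (multrow 0 l C)"
    then have ij: "i < n" "j < n" using C by auto
    show "(S * A) $$ (i,j) = multrow 0 l C $$ (i,j)"
    proof (cases "i = 0")
      case True
      have "(S * A) $$ (0,j) = row (S * A) 0 $ j" using T A ij n_pos by simp
      then show ?thesis using True ij C vc by (simp add: row0) (simp add: C_def)
    qed (use ij C in \<open>simp add: C_def\<close>)
  qed (use T A C in auto)
  have "det S * det T = 1" using det_mult[OF T(1,2)] T(3) by simp
  then have "\<bar>det S\<bar> = 1" using zmult_eq_1_iff by fastforce
  moreover have "det S * det A = l * det C"
    using det_mult[OF T(1) A] det_multrow[OF n_pos C, of l] SA by simp
  ultimately have "l * \<bar>det C\<bar> = l" using det l_pos by (metis abs_mult abs_of_pos mult_1)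
  then have "\<bar>det C\<bar> = 1" using l_pos by simp
  then have dC: "det C * det C = 1" by (metis abs_mult_self_eq mult_1)
  \<comment> \<open>The inverse of \<open>C\<close>: as \<open>det C\<close> is \<open>1\<close> or
    \<open>-1\<close>, multiplying by it is the same as dividing by it.\<close>
  define D where "D = det C \<cdot>\<^sub>m adj_mat C"
  have D: "D \<in> carrier_mat n n" "C * D = 1\<^sub>m n"
  proof -
    show "D \<in> carrier_mat n n" using adj_mat(1)[OF C] by (simp add: D_def)
    have "C * D = det C \<cdot>\<^sub>m (C * adj_mat C)"
      unfolding D_def using C adj_mat(1)[OF C] by (rule mult_smult_distrib)
    also have "\<dots> = 1\<^sub>m n" unfolding adj_mat(2)[OF C] using dC by (intro eq_matI) auto
    finally show "C * D = 1\<^sub>m n" .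
  qed
  obtain q where q: "v \<bullet> y = l * q" using dvd by blast
  \<comment> \<open>The same division by \<open>l\<close> applied to the first coordinate of
    \<open>S *\<^sub>v y\<close>; solving \<open>C *\<^sub>v x = t\<close> then solves
    \<open>(S * A) *\<^sub>v x = S *\<^sub>v y\<close>.\<close>
  define t where "t = vec n (\<lambda>i. if i = 0 then q else (S *\<^sub>v y) $ i)"
  have t: "t \<in> carrier_vec n" by (simp add: t_def)
  define x where "x = D *\<^sub>v t"
  have x: "x \<in> carrier_vec n" using D t by (simp add: x_def)
  have Cx: "C *\<^sub>v x = t" unfolding x_def using assoc_mult_mat_vec[OF C D(1) t] D(2) t by simp
  have "S *\<^sub>v (A *\<^sub>v x) = (S * A) *\<^sub>v x" using assoc_mult_mat_vec[OF T(1) A x] by simp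
  also have "\<dots> = S *\<^sub>v y"
  proof (rule eq_vecI)
    fix i assume "i < dim_vec (S *\<^sub>v y)"
    then have i: "i < n" using T by simp
    have ti: "t $ i = row C i \<bullet> x" using i C by (simp add: Cx[symmetric])
    show "((S * A) *\<^sub>v x) $ i = (S *\<^sub>v y) $ i"
    proof (cases "i = 0")
      case True
      have "row (multrow 0 l C) 0 = l \<cdot>\<^sub>v row C 0" using C n_pos by (intro eq_vecI) auto
      then have "((S * A) *\<^sub>v x) $ 0 = l * (row C 0 \<bullet> x)"
        unfolding SA using C n_pos x by (simp add: smult_scalar_prod_distrib[of _ n])
      also have "row C 0 \<bullet> x = q" using ti True n_pos by (simp add: t_def)
      finally show ?thesis using True q S(2) T n_pos by simp
    next
      case False
      have "row (multrow 0 l C) i = row C i" using C i False by (intro eq_vecI) auto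
      then have "((S * A) *\<^sub>v x) $ i = t $ i" unfolding SA using C i ti by simp
      then show ?thesis using i False by (simp add: t_def)
    qed
  qed (use T A in auto)
  finally have *: "S *\<^sub>v (A *\<^sub>v x) = S *\<^sub>v y" .
  have Ax: "A *\<^sub>v x \<in> carrier_vec n" by (rule mult_mat_vec_carrier[OF A x])
  have "y = T *\<^sub>v (S *\<^sub>v y)" using assoc_mult_mat_vec[OF T(2,1) y] T(4) y by simp
  also have "\<dots> = A *\<^sub>v x" unfolding *[symmetric] using assoc_mult_mat_vec[OF T(2,1) Ax] T(4) Ax by simp
  finally show ?thesis using x by blast
qed

text \<open>Each preimage under \<open>A\<close> has its pairing with \<open>v\<close> divided by
  \<open>l\<close>, so divisibility by \<open>l ^ k\<close> allows \<open>k\<close> steps.\<close>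

lemma mem_range_pow:
  assumes "y \<in> carrier_vec n" "l ^ k dvd v \<bullet> y"
  shows "\<exists>x\<in>carrier_vec n. y = A ^\<^sub>m k *\<^sub>v x"
  using assms
proof (induction k arbitrary: y)
  case 0
  then show ?case using A by (intro bexI[of _ y]) auto
next
  case (Suc k)
  obtain x where x: "x \<in> carrier_vec n" "y = A *\<^sub>v x"
    using mem_range_of_dvd[OF Suc.prems(1)] Suc.prems(2) by (meson dvd_power dvd_trans zero_less_Suc)
  have "v \<bullet> y = l * (v \<bullet> x)" using pow_mat_left_eigenvector[OF A vc v(3) x(1), of 1] A x by simp
  then have "l ^ k dvd v \<bullet> x" using Suc.prems(2) l_pos by simp
  from Suc.IH[OF x(1) this] obtain u where u: "u \<in> carrier_vec n" "x = A ^\<^sub>m k *\<^sub>v u" by blast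
  have "y = A ^\<^sub>m Suc k *\<^sub>v u"
    unfolding pow_mat_Suc_left[OF A] x(2) u(2) by (rule assoc_mult_mat_vec[OF A Ak u(1), symmetric])
  with u show ?case by blast
qed

text \<open>If \<open>c\<close> divides both numbers, then \<open>l / c \<cdot> w\<close> lies in \<open>A \<int>\<^sup>n\<close>, and so \<open>w / c\<close> is integral.\<close>

lemma coprime_pairing: "coprime (v \<bullet> w) l"
proof (rule coprimeI)
  fix c assume c: "c dvd v \<bullet> w" "c dvd l"
  obtain m where m: "l = c * m" using c(2) by blast
  have "l dvd v \<bullet> (m \<cdot>\<^sub>v w)"
    using c(1) m vc wc by (simp add: scalar_prod_smult_distrib[of _ n] mult.commute mult_dvd_mono)
  then obtain x where x: "x \<in> carrier_vec n" "m \<cdot>\<^sub>v w = A *\<^sub>v x"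
    using mem_range_of_dvd[of "m \<cdot>\<^sub>v w"] wc by auto
  \<comment> \<open>Both sides equal \<open>l\<close> times \<open>w\<close>, since
    \<open>l = c * m\<close>. The exponent \<open>1\<close> matches the form of
    \<open>inj_rmat_pow\<close>, which cancels \<open>A\<close>.\<close>
  have "rmat (A ^\<^sub>m 1) *\<^sub>v rvec w = rmat (A ^\<^sub>m 1) *\<^sub>v rvec (c \<cdot>\<^sub>v x)"
  proof -
    have "A *\<^sub>v w = A *\<^sub>v (c \<cdot>\<^sub>v x)"
      unfolding mult_mat_vec_smult[OF A x(1)] x(2)[symmetric] w(3) m smult_smult_assoc ..
    then have "rvec (A *\<^sub>v w) = rvec (A *\<^sub>v (c \<cdot>\<^sub>v x))" by simp
    then show ?thesis using rvec_mult[OF A wc] rvec_mult[OF A, of "c \<cdot>\<^sub>v x"] x A by simp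
  qed
  then have "rvec w = rvec (c \<cdot>\<^sub>v x)" by (rule inj_rmat_pow[rotated 2]) (use wc x in auto)
  then have "w = c \<cdot>\<^sub>v x" by (rule of_int_hom.vec_hom_inj)
  then have "\<forall>i<n. c dvd w $ i" using x by auto
  then show "is_unit c" using w(1) by (simp add: primitive_vec_def)
qed

text \<open>Let \<open>y\<close> be the integral image of \<open>x\<close> under
  \<open>A ^\<^sub>m k\<close>. Subtracting a suitable \<open>s\<close> times \<open>w\<close> puts
  \<open>y\<close> into the range of \<open>A ^\<^sub>m k\<close> on integer vectors, and undoing
  the power divides \<open>s\<close> by \<open>l ^ k\<close>. Conversely,
  \<open>A ^\<^sub>m k\<close> clears the denominator.\<close>

lemma mem_carrier_iff_decomp:
  "x \<in> dim_group_carrier A \<longleftrightarrow>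
    (\<exists>z\<in>carrier_vec n. \<exists>s k. x = rvec z + (of_int s / of_int (l ^ k)) \<cdot>\<^sub>v rvec w)"
proof
  assume "x \<in> dim_group_carrier A"
  then obtain k y where x: "x \<in> carrier_vec n" and y: "y \<in> carrier_vec n"
    "rmat (A ^\<^sub>m k) *\<^sub>v x = rvec y" unfolding mem_carrier_iff by blast
  have "coprime (v \<bullet> w) (l ^ k)" using coprime_pairing by simp
  then obtain a b where ab: "a * (v \<bullet> w) + b * l ^ k = 1" 
    using bezout_int[of "v \<bullet> w" "l ^ k"] by auto
  \<comment> \<open>By Bezout \<open>a\<close> inverts \<open>v \<bullet> w\<close> modulo
    \<open>l ^ k\<close>, so \<open>s * (v \<bullet> w)\<close> is congruent to
    \<open>v \<bullet> y\<close>.\<close>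
  define s where "s = (v \<bullet> y) * a"
  have "v \<bullet> (y - s \<cdot>\<^sub>v w) = v \<bullet> y - s * (v \<bullet> w)"
    using vc wc y by (simp add: scalar_prod_minus_distrib[of _ n])
  also have "\<dots> = (v \<bullet> y) * (1 - a * (v \<bullet> w))" by (simp add: s_def algebra_simps)
  also have "1 - a * (v \<bullet> w) = b * l ^ k" using ab by simp
  finally have "l ^ k dvd v \<bullet> (y - s \<cdot>\<^sub>v w)" by simp
  then obtain z where z: "z \<in> carrier_vec n" "y - s \<cdot>\<^sub>v w = A ^\<^sub>m k *\<^sub>v z"
    using mem_range_pow[of "y - s \<cdot>\<^sub>v w" k] y wc by auto
  have yz: "y = A ^\<^sub>m k *\<^sub>v z + s \<cdot>\<^sub>v w" unfolding z(2)[symmetric] using y wc by (intro eq_vecI) auto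
  have c: "rvec z + (of_int s / of_int (l ^ k)) \<cdot>\<^sub>v rvec w \<in> carrier_vec n" using z wc by simp
  have "rmat (A ^\<^sub>m k) *\<^sub>v (rvec z + (of_int s / of_int (l ^ k)) \<cdot>\<^sub>v rvec w)
    = rmat (A ^\<^sub>m k) *\<^sub>v rvec z + (of_int s / of_int (l ^ k)) \<cdot>\<^sub>v (of_int (l ^ k) \<cdot>\<^sub>v rvec w)"
    using Ak[of k] z(1) wc rmat_pow_w[of k]
    by (simp add: mult_add_distrib_mat_vec[of _ n n] mult_mat_vec_smult[of _ n n])
  also have "\<dots> = rvec y"
    unfolding rvec_mult[OF Ak z(1), symmetric] yz using Ak[of k] wc l_pos by (intro eq_vecI) auto
  finally have "x = rvec z + (of_int s / of_int (l ^ k)) \<cdot>\<^sub>v rvec w"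
    using inj_rmat_pow[OF x c, of k] y(2) by simp
  then show "\<exists>z\<in>carrier_vec n. \<exists>s k. x = rvec z + (of_int s / of_int (l ^ k)) \<cdot>\<^sub>v rvec w"
    using z(1) by blast
next
  assume "\<exists>z\<in>carrier_vec n. \<exists>s k. x = rvec z + (of_int s / of_int (l ^ k)) \<cdot>\<^sub>v rvec w"
  then obtain z s k where z: "z \<in> carrier_vec n"
    and x: "x = rvec z + (of_int s / of_int (l ^ k)) \<cdot>\<^sub>v rvec w" by blast
  have "rmat (A ^\<^sub>m k) *\<^sub>v x
    = rmat (A ^\<^sub>m k) *\<^sub>v rvec z + (of_int s / of_int (l ^ k)) \<cdot>\<^sub>v (of_int (l ^ k) \<cdot>\<^sub>v rvec w)"
    unfolding x using Ak[of k] z(1) wc rmat_pow_w[of k]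
    by (simp add: mult_add_distrib_mat_vec[of _ n n] mult_mat_vec_smult[of _ n n])
  also have "\<dots> = rvec (A ^\<^sub>m k *\<^sub>v z + s \<cdot>\<^sub>v w)"
    unfolding rvec_mult[OF Ak z(1), symmetric] using Ak[of k] wc l_pos by (intro eq_vecI) auto
  finally have "rmat (A ^\<^sub>m k) *\<^sub>v x = rvec (A ^\<^sub>m k *\<^sub>v z + s \<cdot>\<^sub>v w)" .
  moreover have "A ^\<^sub>m k *\<^sub>v z + s \<cdot>\<^sub>v w \<in> carrier_vec n"
    using mult_mat_vec_carrier[OF Ak z] wc by simp
  moreover have "x \<in> carrier_vec n" using x z wc by simp
  ultimately show "x \<in> dim_group_carrier A" unfolding mem_carrier_iff by blast
qed

text \<open>Primitivity supplies a power of \<open>A\<close> whose entries, being positive integers,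
  are at least \<open>1\<close>. The result on real matrices applies to that power, and its powers
  are again powers of \<open>A\<close>.\<close>

lemma eventually_nonneg:
  assumes z: "z \<in> carrier_vec n" "0 < v \<bullet> z"
  shows "\<exists>m. \<forall>i<n. 0 \<le> (A ^\<^sub>m m *\<^sub>v z) $ i"
proof -
  obtain k where k: "\<forall>i<n. \<forall>j<n. 0 < (A ^\<^sub>m k) $$ (i,j)"
    using prim A unfolding primitive_mat_def by auto
  let ?P = "map_mat real_of_int (A ^\<^sub>m k)" and ?r = "map_vec real_of_int"
  have P: "?P \<in> carrier_mat n n" using Ak[of k] by simp
  have pos: "1 \<le> ?P $$ (i,j)" if "i < n" "j < n" for i j
  proof -
    have "1 \<le> (A ^\<^sub>m k) $$ (i,j)" using k that by force
    moreover have "?P $$ (i,j) = real_of_int ((A ^\<^sub>m k) $$ (i,j))"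
      using that carrier_matD[OF Ak[of k]] by (intro index_map_mat) auto
    ultimately show ?thesis by linarith
  qed
  have Pw: "?P *\<^sub>v ?r w = real_of_int (l ^ k) \<cdot>\<^sub>v ?r w"
    unfolding of_int_hom.mult_mat_vec_hom[OF Ak wc, symmetric] pow_mat_eigenvector[OF A wc w(3)]
    by (rule of_int_hom.vec_hom_smult)
  have "?r (transpose_mat (A ^\<^sub>m k) *\<^sub>v v) = map_mat real_of_int (transpose_mat (A ^\<^sub>m k)) *\<^sub>v ?r v"
    by (rule of_int_hom.mult_mat_vec_hom[OF _ vc]) (use Ak in simp)
  then have Pv: "transpose_mat ?P *\<^sub>v ?r v = real_of_int (l ^ k) \<cdot>\<^sub>v ?r v"
    unfolding map_mat_transpose transpose_pow_mat_eigenvector[OF A vc v(3)] of_int_hom.vec_hom_smult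
    by (rule sym)
  have vz: "0 < ?r v \<bullet> ?r z" using z by (simp add: of_int_scalar_prod[OF vc z(1)])
  have "\<exists>m. \<forall>i<n. 0 \<le> (?P ^\<^sub>m m *\<^sub>v ?r z) $ i"
    by (rule positive_mat_eventually_nonneg[OF P pos _ Pw _ _ Pv _ _ vz]) (use v w vc wc z l_pos in auto)
  then obtain m where m: "\<forall>i<n. 0 \<le> (?P ^\<^sub>m m *\<^sub>v ?r z) $ i" by blast
  have "?P ^\<^sub>m m = map_mat real_of_int (A ^\<^sub>m (k * m))"
    by (simp add: of_int_hom.mat_hom_pow[OF Ak] pow_mat_mult[OF A])
  then have "?P ^\<^sub>m m *\<^sub>v ?r z = ?r (A ^\<^sub>m (k * m) *\<^sub>v z)"
    by (simp add: of_int_hom.mult_mat_vec_hom[OF Ak z(1)])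
  then have "\<forall>i<n. 0 \<le> (A ^\<^sub>m (k * m) *\<^sub>v z) $ i" using m Ak[of "k * m"] by (auto simp del: index_mult_mat_vec)
  then show ?thesis by blast
qed

text \<open>Powers of \<open>A\<close> scale the pairing with \<open>v\<close> by a positive factor.
  A nonzero nonnegative \<open>z\<close> pairs positively with the positive \<open>v\<close>;
  conversely, an integral vector of positive pairing becomes nonnegative under a further
  power.\<close>

lemma mem_cone_iff_pairing_pos:
  "x \<in> dim_group_cone A \<longleftrightarrow> x \<in> dim_group_carrier A \<and> (x = 0\<^sub>v n \<or> 0 < rvec v \<bullet> x)"
proof
  assume "x \<in> dim_group_cone A"
  then obtain k z where x: "x \<in> carrier_vec n" and z: "z \<in> carrier_vec n" "\<forall>i<n. 0 \<le> z $ i"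
    "rmat (A ^\<^sub>m k) *\<^sub>v x = rvec z" unfolding mem_cone_iff by blast
  have "x = 0\<^sub>v n \<or> 0 < rvec v \<bullet> x"
  proof (cases "z = 0\<^sub>v n")
    case True
    then have "rmat (A ^\<^sub>m k) *\<^sub>v x = rmat (A ^\<^sub>m k) *\<^sub>v 0\<^sub>v n"
      using z Ak[of k] by (auto intro!: eq_vecI simp: scalar_prod_def)
    then show ?thesis using inj_rmat_pow[OF x, of "0\<^sub>v n"] by simp
  next
    case False
    then obtain i where i: "i < n" "z $ i \<noteq> 0" using z(1) by (metis carrier_vecD eq_vecI index_zero_vec)
    have "0 < v \<bullet> z" unfolding scalar_prod_def
      using i z v(2) by (intro sum_pos2[of _ i]) (auto intro!: mult_pos_pos mult_nonneg_nonneg less_imp_le simp: order_less_le)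
    then have "0 < rvec v \<bullet> rvec z" by (simp add: of_int_scalar_prod[OF vc z(1)])
    then have "0 < of_int (l ^ k) * (rvec v \<bullet> x)" unfolding z(3)[symmetric] v_rmat_pow[OF x] .
    then show ?thesis using l_pos by (simp add: zero_less_mult_iff)
  qed
  then show "x \<in> dim_group_carrier A \<and> (x = 0\<^sub>v n \<or> 0 < rvec v \<bullet> x)"
    using x z unfolding mem_carrier_iff by blast
next
  assume *: "x \<in> dim_group_carrier A \<and> (x = 0\<^sub>v n \<or> 0 < rvec v \<bullet> x)"
  then obtain k y where x: "x \<in> carrier_vec n" and y: "y \<in> carrier_vec n"
    "rmat (A ^\<^sub>m k) *\<^sub>v x = rvec y" unfolding mem_carrier_iff by blast
  show "x \<in> dim_group_cone A"
  proof (cases "x = 0\<^sub>v n")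
    case True
    then have "rmat (A ^\<^sub>m 0) *\<^sub>v x = rvec (0\<^sub>v n)"
      using A by (auto intro!: eq_vecI simp: scalar_prod_def)
    then show ?thesis unfolding mem_cone_iff using x by (intro conjI exI[of _ 0] bexI[of _ "0\<^sub>v n"]) auto
  next
    case False
    then have "0 < of_int (l ^ k) * (rvec v \<bullet> x)" using * l_pos by simp
    then have "0 < rvec v \<bullet> rvec y" unfolding y(2)[symmetric] v_rmat_pow[OF x] .
    then have "0 < v \<bullet> y" by (simp add: of_int_scalar_prod[OF vc y(1)])
    then obtain m where m: "\<forall>i<n. 0 \<le> (A ^\<^sub>m m *\<^sub>v y) $ i" using eventually_nonneg[OF y(1)] by blast
    have "rmat (A ^\<^sub>m (m + k)) *\<^sub>v x = rmat (A ^\<^sub>m m) *\<^sub>v (rmat (A ^\<^sub>m k) *\<^sub>v x)"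
      using assoc_mult_mat_vec[of "rmat (A ^\<^sub>m m)" n n "rmat (A ^\<^sub>m k)" n x] Ak x
      by (simp add: pow_mat_add[OF A] of_int_hom.mat_hom_mult[OF Ak Ak])
    also have "\<dots> = rvec (A ^\<^sub>m m *\<^sub>v y)" by (simp add: y(2) rvec_mult[OF Ak y(1)])
    finally show ?thesis unfolding mem_cone_iff
      using x m mult_mat_vec_carrier[OF Ak y(1), of m] by blast
  qed
qed

end

section \<open>Maps between two dimension groups, and the isomorphism\<close>

lemma dim_group_map:
  assumes "integral_perron n A l v w" "integral_perron n B l' v' w'"
    and U: "U \<in> carrier_mat n n" "U *\<^sub>v w = w'" "transpose_mat U *\<^sub>v v' = v"
    and dvd: "l dvd l' ^ j"
  shows "x \<in> dim_group_carrier A \<Longrightarrow> rmat U *\<^sub>v x \<in> dim_group_carrier B"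
    and "x \<in> dim_group_cone A \<Longrightarrow> rmat U *\<^sub>v x \<in> dim_group_cone B"
proof -
  interpret A: integral_perron n A l v w by fact
  interpret B: integral_perron n B l' v' w' by fact
  have Uq: "rmat U \<in> carrier_mat n n" using U by simp
  show carrier: "rmat U *\<^sub>v x \<in> dim_group_carrier B" if x: "x \<in> dim_group_carrier A" for x
  proof -
    obtain z s k where z: "z \<in> carrier_vec n"
      and x: "x = rvec z + (of_int s / of_int (l ^ k)) \<cdot>\<^sub>v rvec w"
      using x unfolding A.mem_carrier_iff_decomp by blast
    \<comment> \<open>The cofactor \<open>t\<close> rewrites a denominator \<open>l ^ k\<close> as
      \<open>l' ^ (j * k)\<close>, at the cost of a factor \<open>t ^ k\<close> in the
      numerator.\<close>
    obtain t where t: "l' ^ j = l * t" using dvd by blast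
    have "l' ^ (j * k) = l ^ k * t ^ k" by (simp add: power_mult t power_mult_distrib)
    moreover have "t \<noteq> 0" using t B.l_pos by auto
    ultimately have q: "rat_of_int s / of_int (l ^ k) = of_int (s * t ^ k) / of_int (l' ^ (j * k))"
      using A.l_pos by (simp add: field_simps)
    have "rmat U *\<^sub>v x = rmat U *\<^sub>v rvec z + (of_int s / of_int (l ^ k)) \<cdot>\<^sub>v (rmat U *\<^sub>v rvec w)"
      unfolding x using Uq z A.wc
      by (simp add: mult_add_distrib_mat_vec[of _ n n] mult_mat_vec_smult[of _ n n])
    also have "\<dots> = rvec (U *\<^sub>v z) + (of_int (s * t ^ k) / of_int (l' ^ (j * k))) \<cdot>\<^sub>v rvec w'"
      unfolding q U(2)[symmetric] rvec_mult[OF U(1) z] rvec_mult[OF U(1) A.wc] ..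
    finally show ?thesis
      unfolding B.mem_carrier_iff_decomp using mult_mat_vec_carrier[OF U(1) z] by blast
  qed
  assume x: "x \<in> dim_group_cone A"
  then have xc: "x \<in> carrier_vec n" unfolding A.mem_cone_iff by blast
  \<comment> \<open>The transposed equation says that \<open>U\<close> preserves the pairing with
    the left eigenvectors, whose sign decides membership in the cone.\<close>
  have "transpose_mat (rmat U) *\<^sub>v rvec v' = rvec v"
    using rvec_mult[of "transpose_mat U" n v'] U B.vc by (simp add: map_mat_transpose)
  then have "rvec v' \<bullet> (rmat U *\<^sub>v x) = rvec v \<bullet> x"
    using transpose_vec_mult_scalar[OF Uq xc, of "rvec v'"] B.vc by simp
  moreover have "rmat U *\<^sub>v 0\<^sub>v n = 0\<^sub>v n" using Uq by (intro eq_vecI) (auto simp: scalar_prod_def)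
  ultimately show "rmat U *\<^sub>v x \<in> dim_group_cone B"
    using x carrier unfolding A.mem_cone_iff_pairing_pos B.mem_cone_iff_pairing_pos by auto
qed

text \<open>Every prime factor of \<open>a\<close>, counted with multiplicity, is absorbed by one
  further factor \<open>b\<close>.\<close>

lemma dvd_power_of_prime_divisors:
  fixes a b :: int
  assumes "a \<noteq> 0" "\<And>p. prime p \<Longrightarrow> p dvd a \<Longrightarrow> p dvd b"
  shows "\<exists>j. a dvd b ^ j"
  using assms
proof (induction a rule: prime_divisors_induct)
  case (unit a)
  then show ?case by (auto intro: exI[of _ 0])
next
  case (factor p a)
  then obtain j where "a dvd b ^ j" by auto
  moreover have "p dvd b" using factor by auto
  ultimately have "p * a dvd b ^ Suc j" by (simp add: mult_dvd_mono)
  then show ?case by blast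
qed simp

lemma Gcd_vec_primitive:
  assumes "x \<in> carrier_vec n" "Gcd (set\<^sub>v x) = 1"
  shows "primitive_vec n x"
  unfolding primitive_vec_def
proof (intro conjI allI impI)
  fix c assume "\<forall>i<n. c dvd x $ i"
  then have "c dvd Gcd (set\<^sub>v x)" using assms by (intro Gcd_greatest) (auto simp: vec_set_def)
  then show "is_unit c" using assms by simp
qed (use assms in simp)

text \<open>Uniqueness of the Perron eigenvalue identifies the real \<open>m\<close> hidden in the
  definition of the eigenvectors with the integer \<open>l\<close>, and the equation descends to the
  integers. \<open>M\<close> is kept apart from \<open>A\<close> to cover its transpose as
  well.\<close>

lemma perron_int_eigenvector:
  assumes "perron_eigenvalue A (real_of_int l)" "perron_eigenvalue A m" "M \<in> carrier_mat n n"
    and "eigenvector (map_mat real_of_int M) (map_vec real_of_int x) m"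
  shows "x \<in> carrier_vec n" "M *\<^sub>v x = l \<cdot>\<^sub>v x"
proof -
  have m: "m = real_of_int l" by (rule perron_eigenvalue_unique[OF assms(2,1)])
  show x: "x \<in> carrier_vec n" using assms(3,4) by (auto simp: eigenvector_def)
  have "map_vec real_of_int (M *\<^sub>v x) = map_vec real_of_int (l \<cdot>\<^sub>v x)"
    using assms(4) unfolding eigenvector_def m of_int_hom.mult_mat_vec_hom[OF assms(3) x]
      of_int_hom.vec_hom_smult by simp
  then show "M *\<^sub>v x = l \<cdot>\<^sub>v x" by (rule of_int_hom.vec_hom_inj)
qed

lemma integral_perronI:
  assumes A: "A \<in> carrier_mat n n" and "primitive_mat A"
    and l: "perron_eigenvalue A (real_of_int l)" and "l = \<bar>det A\<bar>"
    and v: "left_perron_vector A v" and w: "right_perron_vector A w"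
  shows "integral_perron n A l v w"
proof -
  have "v \<in> carrier_vec n" "transpose_mat A *\<^sub>v v = l \<cdot>\<^sub>v v"
    using perron_int_eigenvector[OF l, of _ "transpose_mat A" n v] v A
    unfolding left_perron_vector_def by (auto simp: map_mat_transpose)
  moreover have "w \<in> carrier_vec n" "A *\<^sub>v w = l \<cdot>\<^sub>v w"
    using perron_int_eigenvector[OF l _ A, of _ w] w unfolding right_perron_vector_def by auto
  moreover have "0 < l" using l by (simp add: perron_eigenvalue_def)
  ultimately show ?thesis
    using assms Gcd_vec_primitive[of v n] Gcd_vec_primitive[of w n]
    by unfold_locales (auto simp: left_perron_vector_def right_perron_vector_def)
qed

text \<open>The inverse \<open>V\<close> carries the second pair of eigenvectors back to the first,
  so \<open>dim_group_map\<close> applies in both directions and gives mutually inverse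
  maps.\<close>

lemma dim_group_iso_mult_mat:
  assumes A: "integral_perron n A l v w" and B: "integral_perron n B l' v' w'"
    and U: "U \<in> carrier_mat n n" "V \<in> carrier_mat n n" "U * V = 1\<^sub>m n" "V * U = 1\<^sub>m n"
    and Uw: "U *\<^sub>v w = w'" and Uv: "transpose_mat U *\<^sub>v v' = v"
    and dvd: "l dvd l' ^ j" "l' dvd l ^ k"
  shows "ordered_dim_group_iso A B ((*\<^sub>v) (rmat U))"
proof -
  interpret A: integral_perron n A l v w by fact
  interpret B: integral_perron n B l' v' w' by fact
  have Vw: "V *\<^sub>v w' = w"
    using assoc_mult_mat_vec[OF U(2,1) A.wc] U(4) A.wc by (simp add: Uw)
  have "transpose_mat V * transpose_mat U = 1\<^sub>m n"
    unfolding transpose_mult[OF U(1,2), symmetric] U(3) by simp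
  then have Vv: "transpose_mat V *\<^sub>v v = v'"
    using assoc_mult_mat_vec[of "transpose_mat V" n n "transpose_mat U" n v'] U(1,2) B.vc
    by (simp add: Uv)
  note UM = dim_group_map[OF A B U(1) Uw Uv dvd(1)]
  note VM = dim_group_map[OF B A U(2) Vw Vv dvd(2)]
  have Uq: "rmat U \<in> carrier_mat n n" "rmat V \<in> carrier_mat n n" using U by auto
  have inv: "rmat U * rmat V = 1\<^sub>m n" "rmat V * rmat U = 1\<^sub>m n"
    unfolding of_int_hom.mat_hom_mult[OF U(1,2), symmetric] of_int_hom.mat_hom_mult[OF U(2,1), symmetric] U(3,4)
    by (rule of_int_hom.mat_hom_one)+
  have UV: "rmat U *\<^sub>v (rmat V *\<^sub>v x) = x" "rmat V *\<^sub>v (rmat U *\<^sub>v x) = x" if "x \<in> carrier_vec n" for x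
    using assoc_mult_mat_vec[OF Uq that] assoc_mult_mat_vec[OF Uq(2,1) that] inv that by auto
  have GA: "x \<in> carrier_vec n" if "x \<in> dim_group_carrier A" for x using that A.mem_carrier_iff by blast
  have GB: "x \<in> carrier_vec n" if "x \<in> dim_group_carrier B" for x using that B.mem_carrier_iff by blast
  have PA: "x \<in> carrier_vec n" if "x \<in> dim_group_cone B" for x using that B.mem_cone_iff by blast
  have "(*\<^sub>v) (rmat U) \<in> hom (dim_group A) (dim_group B)"
    using UM GA mult_add_distrib_mat_vec[OF Uq(1)]
    by (auto simp: hom_def dim_group_def monoid_vec_def)
  moreover have "bij_betw ((*\<^sub>v) (rmat U)) (dim_group_carrier A) (dim_group_carrier B)"
    by (rule bij_betw_byWitness[of _ "(*\<^sub>v) (rmat V)"]) (use UV UM VM GA GB in auto)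
  moreover have "(*\<^sub>v) (rmat U) ` dim_group_cone A = dim_group_cone B"
  proof
    show "dim_group_cone B \<subseteq> (*\<^sub>v) (rmat U) ` dim_group_cone A"
      using UV PA VM by (metis image_eqI subsetI)
  qed (use UM in auto)
  ultimately show ?thesis by (simp add: ordered_dim_group_iso_def iso_def dim_group_def)
qed

theorem corollary7p2:
  fixes N :: nat and A B :: "int mat" and lA lB :: int and vA wA vB wB :: "int vec"
  assumes "N \<ge> 3"
    and "A \<in> carrier_mat N N" and "B \<in> carrier_mat N N"
    and "det A \<noteq> 0" and "det B \<noteq> 0"
    and "primitive_mat A" and "primitive_mat B"
    and "perron_eigenvalue A (real_of_int lA)" and "perron_eigenvalue B (real_of_int lB)"
    and "lA = \<bar>det A\<bar>" and "lB = \<bar>det B\<bar>"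
    and "\<And>p::int. prime p \<Longrightarrow> p dvd lA \<longleftrightarrow> p dvd lB"
    and "left_perron_vector A vA" and "right_perron_vector A wA"
    and "left_perron_vector B vB" and "right_perron_vector B wB"
    and "vA \<bullet> wA = vB \<bullet> wB"
  shows "\<exists>f. ordered_dim_group_iso A B f"
proof -
  have A: "integral_perron N A lA vA wA" and B: "integral_perron N B lB vB wB"
    using assms by (auto intro!: integral_perronI)
  interpret A: integral_perron N A lA vA wA by (rule A)
  interpret B: integral_perron N B lB vB wB by (rule B)
  obtain U V where U: "U \<in> carrier_mat N N" "V \<in> carrier_mat N N" "U * V = 1\<^sub>m N" "V * U = 1\<^sub>m N"
    "U *\<^sub>v wA = wB" "transpose_mat U *\<^sub>v vB = vA"
    using unimodular_pairs_transitive[OF A.v(1) A.w(1) B.v(1) B.w(1) assms(17,1)] by blast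
  obtain j k where "lA dvd lB ^ j" "lB dvd lA ^ k"
    using dvd_power_of_prime_divisors[of lA lB] dvd_power_of_prime_divisors[of lB lA]
      A.l_pos B.l_pos assms(12) by auto
  from dim_group_iso_mult_mat[OF A B U this] show ?thesis by blast
qed

end
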